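(* Every chordal graph is $2,d$-perfect for all odd positive integers $d$.
   Context: All graphs are simple and undirected with nonempty vertex set. A graph is chordal if every cycle of length at least $4$ in it has a chord. A shortest path in a graph $G$ is a path between some vertices $u,v$ whose length (number of edges) equals the graph distance between $u$ and $v$. A set $S\subseteq V(G)$ is $k,d$-independent in $G$ if every shortest path in $G$ of length at most $d$ contains fewer than $k$ vertices of $S$. The $k,d$-chromatic number $\chi^k_d(G)$ is the least positive integer $c$ such that some coloring $V(G)\to\{1,\dots,c\}$ has all color classes $k,d$-independent. A set $S\subseteq V(G)$ is a $k,d$-clique in $G$ if every $k$-element subset of $S$ is contained in some shortest path of $G$ of length at most $d$ (sets with fewer than $k$ elements are vacuously $k,d$-cliques); $\omega^k_d(G)$ is the supremum of the sizes of $k,d$-cliques in $G$. For $2\le k\le d+1$, $G$ is $k,d$-perfect if $\chi^k_d(H)=\left\lceil\frac{\omega^k_d(H)}{k-1}\right\rceil$ for every induced subgraph $H$ of $G$ (shortest paths being computed in $H$). Thus $G$ is $2,d$-perfect when $\chi^2_d(H)=\omega^2_d(H)$ for every induced subgraph $H$. *)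

theory Defs
  imports "Graph_Theory.Graph_Theory" "HOL-Library.Extended_Nat"
begin

text \<open>
  An undirected edge is represented by the two opposite arcs between its ends. Graphs may be
  infinite, so both graph invariants below take values in \<^typ>\<open>enat\<close>.
\<close>

definition simple_graph :: "'a pair_pre_digraph \<Rightarrow> bool" where
  "simple_graph G \<longleftrightarrow> pair_bidirected_digraph G \<and> pverts G \<noteq> {}"

text \<open>
  A cycle is a list of arcs; since it is closed, the tails of its arcs are all of its vertices.
  The closed walk \<open>u, v, u\<close> is also a \<^const>\<open>pre_digraph.cycle\<close>, but it is excluded by
  the bound on the length.
\<close>

definition chordal :: "'a pair_pre_digraph \<Rightarrow> bool" where
  "chordal G \<longleftrightarrow> (\<forall>p. pre_digraph.cycle (with_proj G) p \<and> length p \<ge> 4 \<longrightarrow>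
     (\<exists>x \<in> fst ` set p. \<exists>y \<in> fst ` set p.
        (x, y) \<in> parcs G \<and> (x, y) \<notin> set p \<and> (y, x) \<notin> set p))"

definition graph_dist :: "'a pair_pre_digraph \<Rightarrow> 'a \<Rightarrow> 'a \<Rightarrow> ereal" where
  "graph_dist G u v = wf_digraph.\<mu> (with_proj G) (\<lambda>_. 1) u v"

definition shortest_path :: "'a pair_pre_digraph \<Rightarrow> 'a vwalk \<Rightarrow> bool" where
  "shortest_path G p \<longleftrightarrow> vpath p (with_proj G) \<and>
     ereal (real (vwalk_length p)) = graph_dist G (hd p) (last p)"

definition kd_independent :: "nat \<Rightarrow> nat \<Rightarrow> 'a pair_pre_digraph \<Rightarrow> 'a set \<Rightarrow> bool" where
  "kd_independent k d G S \<longleftrightarrow> S \<subseteq> pverts G \<and>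
     (\<forall>p. shortest_path G p \<and> vwalk_length p \<le> d \<longrightarrow> card (set p \<inter> S) < k)"

text \<open>The value is \<open>\<infinity>\<close>, the infimum of the empty set, if no finite number of colors suffices.\<close>

definition kd_chromatic :: "nat \<Rightarrow> nat \<Rightarrow> 'a pair_pre_digraph \<Rightarrow> enat" where
  "kd_chromatic k d G = Inf {enat c | c. c \<ge> 1 \<and>
     (\<exists>f. f ` pverts G \<subseteq> {1..c} \<and>
        (\<forall>i \<in> {1..c}. kd_independent k d G {v \<in> pverts G. f v = i}))}"

definition kd_clique :: "nat \<Rightarrow> nat \<Rightarrow> 'a pair_pre_digraph \<Rightarrow> 'a set \<Rightarrow> bool" where
  "kd_clique k d G S \<longleftrightarrow> S \<subseteq> pverts G \<and>
     (\<forall>T \<subseteq> S. finite T \<and> card T = k \<longrightarrow>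
        (\<exists>p. shortest_path G p \<and> vwalk_length p \<le> d \<and> T \<subseteq> set p))"

definition kd_clique_number :: "nat \<Rightarrow> nat \<Rightarrow> 'a pair_pre_digraph \<Rightarrow> enat" where
  "kd_clique_number k d G =
     (SUP S \<in> {S. kd_clique k d G S}. if finite S then enat (card S) else \<infinity>)"

definition ceil_div :: "enat \<Rightarrow> nat \<Rightarrow> enat" where
  "ceil_div w m = (case w of enat n \<Rightarrow> enat (nat \<lceil>real n / real m\<rceil>) | \<infinity> \<Rightarrow> \<infinity>)"

text \<open>Only meaningful for \<open>2 \<le> k \<le> d + 1\<close>.\<close>

definition kd_perfect :: "nat \<Rightarrow> nat \<Rightarrow> 'a pair_pre_digraph \<Rightarrow> bool" where
  "kd_perfect k d G \<longleftrightarrow>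
     (\<forall>H :: 'a pair_pre_digraph.
        induced_subgraph (with_proj H) (with_proj G) \<and> pverts H \<noteq> {} \<longrightarrow>
        kd_chromatic k d H = ceil_div (kd_clique_number k d H) (k - 1))"

end

(* For odd d = 2m + 1 the 2,d-parameters are the chromatic and the clique number of the d-th power.
   Let r be the position in a perfect elimination ordering of a finite chordal graph. In a connected
   set every vertex that is not r-minimal has an r-smaller neighbour inside the set. Order the
   vertices u by the minimum of r on the ball B(u, m). If v comes last among u, u', v and both u and
   u' lie within distance d of v, let x be the r-minimal vertex of B(v, m). Then B(u, m) and B(u', m)
   each contain x or an r-smaller neighbour of x, and these two vertices are equal or adjacent, so u
   and u' are within distance d. Hence greedy colouring in this order uses only as many colours as
   the largest clique of the power requires. Infinite graphs follow by compactness. *)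

theory Submission
  imports Defs "HOL-Analysis.Function_Topology"
begin

section \<open>Shortening walks to induced paths\<close>

lemma set_vwalk_arcs_append_Cons:
  "set (vwalk_arcs (a @ x # b)) = set (vwalk_arcs (a @ [x])) \<union> set (vwalk_arcs (x # b))"
  by (induction a rule: vwalk_arcs.induct) auto

text \<open>By induction on the length: a repeated vertex or a chord gives a strictly shorter walk
  with the same ends inside \<open>set p\<close>, and a walk with neither is already as required. It
  serves for the chordality argument and for producing shortest paths.\<close>

lemma induced_vwalk:
  fixes E :: "'a rel"
  assumes "p \<noteq> []" "set (vwalk_arcs p) \<subseteq> E" "sym E"
  shows "\<exists>q. q \<noteq> [] \<and> hd q = hd p \<and> last q = last p \<and> set q \<subseteq> set p \<and> distinct q \<and>
    set (vwalk_arcs q) \<subseteq> E \<and>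
    (\<forall>x\<in>set q. \<forall>y\<in>set q. (x, y) \<in> E \<longrightarrow> x = y \<or>
       (x, y) \<in> set (vwalk_arcs q) \<or> (y, x) \<in> set (vwalk_arcs q))"
  using assms(1,2)
proof (induction "length p" arbitrary: p rule: less_induct)
  case less
  have shorter: ?case if q: "q \<noteq> []" "hd q = hd p" "last q = last p" "set q \<subseteq> set p"
    "set (vwalk_arcs q) \<subseteq> E" "length q < length p" for q
    using less.hyps[OF q(6,1,5)] q by (metis subset_trans)
  \<comment> \<open>The edge from \<open>x\<close> to \<open>y\<close> replaces the detour through
    \<open>b\<close>; \<open>b\<close> being nonempty makes the walk strictly shorter.\<close>
  have shortcut: ?case if p: "p = a @ x # b @ y # c" and b: "b \<noteq> []" and xy: "(x, y) \<in> E" for a b c x y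
  proof (rule shorter)
    show "set (vwalk_arcs (a @ x # y # c)) \<subseteq> E"
      using less.prems(2) xy unfolding p
      by (simp add: set_vwalk_arcs_append_Cons[of a x "b @ y # c"]
          set_vwalk_arcs_append_Cons[of a x "y # c"]
          set_vwalk_arcs_append_Cons[of "x # b" y c, simplified])
  qed (use b in \<open>auto simp: p hd_append\<close>)
  show ?case
  proof (cases "distinct p")
    case False
    then obtain a x b c where p: "p = a @ [x] @ b @ [x] @ c"
      using not_distinct_decomp by blast
    show ?thesis
    proof (rule shorter)
      show "set (vwalk_arcs (a @ x # c)) \<subseteq> E"
        using less.prems(2) unfolding p
        by (simp add: set_vwalk_arcs_append_Cons[of a x "b @ x # c"]
            set_vwalk_arcs_append_Cons[of a x c]
            set_vwalk_arcs_append_Cons[of "x # b" x c, simplified])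
    qed (auto simp: p hd_append)
  next
    case True
    have chord: ?thesis if "x \<in> set p" "y \<in> set p" "(x, y) \<in> E" "x \<noteq> y"
      "(x, y) \<notin> set (vwalk_arcs p)" "(y, x) \<notin> set (vwalk_arcs p)" for x y
    proof -
      \<comment> \<open>This treats a chord whose first end comes first on the walk; the other order
        follows by symmetry of \<open>E\<close>.\<close>
      have *: ?thesis if xy: "p = a @ x # r" "y \<in> set r" "(x, y) \<in> E" "(x, y) \<notin> set (vwalk_arcs p)"
        for a r x y
      proof -
        obtain b c where r: "r = b @ y # c" using xy(2) by (meson split_list)
        have "b \<noteq> []" using xy(4) unfolding xy(1) r
          by (auto simp: set_vwalk_arcs_append_Cons[of a x "y # c"])
        then show ?thesis using shortcut xy(1,3) r by auto
      qed
      obtain a r where p: "p = a @ x # r" using \<open>x \<in> set p\<close> by (meson split_list)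
      show ?thesis
      proof (cases "y \<in> set r")
        case True
        then show ?thesis using * p that by blast
      next
        case False
        then have "y \<in> set a" using that p by auto
        then obtain a1 a2 where "a = a1 @ y # a2" by (meson split_list)
        then have "p = a1 @ y # (a2 @ x # r)" using p by simp
        then show ?thesis using *[of a1 y "a2 @ x # r" x] that assms(3) by (auto dest: symD)
      qed
    qed
    show ?thesis
      using chord True less.prems by blast
  qed
qed

text \<open>The last conjunct confines the walk to what is reachable from \<open>a\<close>, so that
  it can be kept inside one component.\<close>

lemma rtrancl_imp_vwalk:
  assumes "(a, b) \<in> R\<^sup>*"
  shows "\<exists>p. p \<noteq> [] \<and> hd p = a \<and> last p = b \<and> set (vwalk_arcs p) \<subseteq> R \<and> set p \<subseteq> {c. (a, c) \<in> R\<^sup>*}"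
  using assms
proof (induction rule: rtrancl_induct)
  case base
  show ?case by (rule exI[of _ "[a]"]) auto
next
  case (step y z)
  then obtain p where p: "p \<noteq> []" "hd p = a" "last p = y" "set (vwalk_arcs p) \<subseteq> R"
    "set p \<subseteq> {c. (a, c) \<in> R\<^sup>*}" by blast
  then show ?case
    using step by (intro exI[of _ "p @ [z]"]) (auto simp: vwalk_arcs_append)
qed

section \<open>Chordal relations, simplicial vertices and elimination orderings\<close>

text \<open>Chordality is phrased for the bare adjacency relation, a cycle being a list of distinct
  vertices closed up by its head, so that vertices can be manipulated without arc walks.\<close>

locale chordal_relation =
  fixes E :: "'a rel"
  assumes sym_E: "sym E"
    and irrefl_E: "irrefl E"
    and chord: "\<lbrakk>distinct p; length p \<ge> 4; set (vwalk_arcs (p @ [hd p])) \<subseteq> E\<rbrakk> \<Longrightarrow>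
      \<exists>x\<in>set p. \<exists>y\<in>set p. (x, y) \<in> E \<and> (x, y) \<notin> set (vwalk_arcs (p @ [hd p])) \<and>
        (y, x) \<notin> set (vwalk_arcs (p @ [hd p]))"
begin

definition simplicial :: "'a set \<Rightarrow> 'a \<Rightarrow> bool" where
  "simplicial W x \<longleftrightarrow> (\<forall>y\<in>W. \<forall>z\<in>W. (x, y) \<in> E \<and> (x, z) \<in> E \<and> y \<noteq> z \<longrightarrow> (y, z) \<in> E)"

lemma commute_E: "(x, y) \<in> E \<longleftrightarrow> (y, x) \<in> E"
  using sym_E by (auto dest: symD)

text \<open>If \<open>s\<close> and \<open>t\<close> were not adjacent, an induced path from
  \<open>s\<close> to \<open>t\<close> through \<open>p\<close> would close up with \<open>v\<close>
  to a cycle of length at least 4. It has no chord: \<open>v\<close> sees only \<open>s\<close> and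
  \<open>t\<close> on it, and the path is induced.\<close>

lemma neighbours_joined_outside_adjacent:
  assumes vs: "(v, s) \<in> E" "(v, t) \<in> E" "s \<noteq> t"
    and p: "p \<noteq> []" "set (vwalk_arcs p) \<subseteq> E" "(s, hd p) \<in> E" "(last p, t) \<in> E"
    and p_outside: "\<And>x. x \<in> set p \<Longrightarrow> x \<noteq> v \<and> (v, x) \<notin> E"
  shows "(s, t) \<in> E"
proof (rule ccontr)
  assume st: "(s, t) \<notin> E"
  let ?w = "s # p @ [t]"
  have "set (vwalk_arcs ?w) \<subseteq> E"
    using p by (auto simp: vwalk_arcs_append)
  from induced_vwalk[OF _ this sym_E] obtain q where q: "q \<noteq> []" "hd q = s" "last q = t"
    "set q \<subseteq> set ?w" "distinct q" "set (vwalk_arcs q) \<subseteq> E"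
    and ind: "\<And>x y. \<lbrakk>x \<in> set q; y \<in> set q; (x, y) \<in> E\<rbrakk> \<Longrightarrow>
      x = y \<or> (x, y) \<in> set (vwalk_arcs q) \<or> (y, x) \<in> set (vwalk_arcs q)"
    by (auto 0 4)
  have nv: "v \<noteq> s" "v \<noteq> t" "v \<notin> set q"
    using vs irrefl_E p_outside[of v] q(4) by (auto simp: irrefl_def)
  have len: "length q \<ge> 3"
  proof -
    obtain q1 where q1: "q = s # q1" using q by (cases q) auto
    then obtain y q2 where q2: "q1 = y # q2" using q vs by (cases q1) auto
    have "q2 \<noteq> []" using q st q1 q2 by auto
    then show ?thesis using q1 q2 by (cases q2) auto
  qed
  let ?c = "v # q"
  have arcs: "vwalk_arcs (?c @ [hd ?c]) = (v, s) # vwalk_arcs q @ [(t, v)]"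
    using q by (simp add: vwalk_arcs_append)
  have "\<exists>x\<in>set ?c. \<exists>y\<in>set ?c. (x, y) \<in> E \<and> (x, y) \<notin> set (vwalk_arcs (?c @ [hd ?c])) \<and>
        (y, x) \<notin> set (vwalk_arcs (?c @ [hd ?c]))"
    by (rule chord) (use q nv len vs commute_E arcs in auto)
  then obtain x y where xy: "x \<in> set ?c" "y \<in> set ?c" "(x, y) \<in> E"
    "(x, y) \<notin> insert (v, s) (insert (t, v) (set (vwalk_arcs q)))"
    "(y, x) \<notin> insert (v, s) (insert (t, v) (set (vwalk_arcs q)))"
    unfolding arcs by auto
  have adj_v: "z = s \<or> z = t" if "z \<in> set q" "(v, z) \<in> E" for z
    using that q(4) p_outside by auto
  have "x \<noteq> y" using xy irrefl_E by (auto simp: irrefl_def)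
  consider "x = v" | "y = v" | "x \<in> set q" "y \<in> set q" using xy by auto
  then show False
  proof cases
    case 1
    then have "y \<in> set q" using xy \<open>x \<noteq> y\<close> by auto
    then show False using adj_v xy 1 by auto
  next
    case 2
    then have "x \<in> set q" using xy \<open>x \<noteq> y\<close> by auto
    then show False using adj_v xy 2 commute_E by auto
  next
    case 3
    then show False using ind xy \<open>x \<noteq> y\<close> by blast
  qed
qed

text \<open>
  Dirac's theorem, with the excluded vertex \<open>v\<close> added so that the induction works: the neighbours of a
  component of the non-neighbours of \<open>v\<close> form a clique, and the induction hypothesis applied to a
  suitable vertex of that clique or of the component gives a simplicial vertex of the component.
\<close>

lemma ex_simplicial_nonneighbour:
  assumes "finite W" "v \<in> W" "w \<in> W" "w \<noteq> v" "(v, w) \<notin> E"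
  shows "\<exists>x\<in>W. x \<noteq> v \<and> (v, x) \<notin> E \<and> simplicial W x"
  using assms
proof (induction W arbitrary: v w rule: finite_psubset_induct)
  case (psubset W)
  \<comment> \<open>\<open>C\<close> is the component of \<open>w\<close> among the non-neighbours
    \<open>X\<close> of \<open>v\<close>, and \<open>S\<close> consists of the neighbours of
    \<open>v\<close> attached to \<open>C\<close>.\<close>
  define X where "X = {x \<in> W. x \<noteq> v \<and> (v, x) \<notin> E}"
  define R where "R = E \<inter> X \<times> X"
  define C where "C = {c. (w, c) \<in> R\<^sup>*}"
  define S where "S = {s \<in> W. (v, s) \<in> E \<and> (\<exists>c\<in>C. (c, s) \<in> E)}"
  have "w \<in> X" "w \<in> C" using psubset.prems by (auto simp: X_def C_def)
  have "C \<subseteq> X"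
  proof
    fix c assume "c \<in> C"
    then have "(w, c) \<in> R\<^sup>*" by (simp add: C_def)
    then show "c \<in> X" by (induction) (auto simp: R_def \<open>w \<in> X\<close>)
  qed
  have sym_R: "sym R" using commute_E by (auto simp: R_def sym_def)
  have S_clique: "(s, t) \<in> E" if "s \<in> S" "t \<in> S" "s \<noteq> t" for s t
  proof -
    obtain a b where ab: "a \<in> C" "b \<in> C" "(a, s) \<in> E" "(b, t) \<in> E"
      using \<open>s \<in> S\<close> \<open>t \<in> S\<close> by (auto simp: S_def)
    have "(a, b) \<in> R\<^sup>*"
      using ab sym_rtrancl[OF sym_R] by (auto simp: C_def dest: symD intro: rtrancl_trans)
    from rtrancl_imp_vwalk[OF this] obtain p where p: "p \<noteq> []" "hd p = a" "last p = b"
      "set (vwalk_arcs p) \<subseteq> R" "set p \<subseteq> {c. (a, c) \<in> R\<^sup>*}" by blast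
    have "set p \<subseteq> C" using p(5) ab by (auto simp: C_def intro: rtrancl_trans)
    then have "\<And>x. x \<in> set p \<Longrightarrow> x \<noteq> v \<and> (v, x) \<notin> E" using \<open>C \<subseteq> X\<close> by (auto simp: X_def)
    then show ?thesis
      using neighbours_joined_outside_adjacent[of v s t p] p ab that commute_E
      by (auto simp: S_def R_def)
  qed
  let ?W = "C \<union> S"
  \<comment> \<open>The inclusion is proper because \<open>v\<close> belongs neither to
    \<open>C\<close> nor to \<open>S\<close>.\<close>
  have sub: "?W \<subset> W" using \<open>C \<subseteq> X\<close> psubset.prems irrefl_E
    by (auto simp: X_def S_def irrefl_def)
  have nbr: "y \<in> ?W" if "c \<in> C" "y \<in> W" "(c, y) \<in> E" for c y
  proof (cases "(v, y) \<in> E")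
    case True
    then show ?thesis using that by (auto simp: S_def)
  next
    case False
    have "c \<in> X" using that \<open>C \<subseteq> X\<close> by auto
    then have "y \<in> X" using that False commute_E by (auto simp: X_def)
    then have "(c, y) \<in> R" using that \<open>c \<in> X\<close> by (auto simp: R_def)
    then show ?thesis using that by (auto simp: C_def)
  qed
  \<comment> \<open>By \<open>nbr\<close> a vertex of \<open>C\<close> has all its neighbours from
    \<open>W\<close> in \<open>?W\<close>, so being simplicial carries over from \<open>?W\<close>
    to \<open>W\<close>.\<close>
  have lift: ?case if "c \<in> C" "simplicial ?W c" for c
    using that \<open>C \<subseteq> X\<close> nbr by (auto simp: simplicial_def X_def)
  show ?case
  \<comment> \<open>With such an \<open>s\<close> as excluded vertex, the simplicial vertex found is
    not adjacent to \<open>s\<close>, hence not in the clique \<open>S\<close>, hence in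
    \<open>C\<close>. Otherwise \<open>S\<close> is joined to everything, so an excluded vertex from
    \<open>C\<close> also forces the answer into \<open>C\<close>; if no pair is non-adjacent,
    \<open>?W\<close> is complete and \<open>w\<close> itself works.\<close>
  proof (cases "\<exists>s\<in>S. \<exists>y\<in>?W. y \<noteq> s \<and> (s, y) \<notin> E")
    case True
    then obtain s y where s: "s \<in> S" "y \<in> ?W" "y \<noteq> s" "(s, y) \<notin> E" by blast
    then obtain x where "x \<in> ?W" "x \<noteq> s" "(s, x) \<notin> E" "simplicial ?W x"
      using psubset.IH[OF sub, of s y] by auto
    then show ?thesis using lift S_clique s by blast
  next
    case False
    then have S_universal: "(s, y) \<in> E" if "s \<in> S" "y \<in> ?W" "y \<noteq> s" for s y
      using that by auto
    show ?thesis
    proof (cases "\<exists>c\<in>C. \<exists>y\<in>?W. y \<noteq> c \<and> (c, y) \<notin> E")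
      case True
      then obtain c y where c: "c \<in> C" "y \<in> ?W" "y \<noteq> c" "(c, y) \<notin> E" by blast
      then obtain x where x: "x \<in> ?W" "x \<noteq> c" "(c, x) \<notin> E" "simplicial ?W x"
        using psubset.IH[OF sub, of c y] by auto
      have "x \<in> C"
      proof (rule ccontr)
        assume "x \<notin> C"
        then have "x \<in> S" using x(1) by simp
        then have "(x, c) \<in> E" using S_universal[of x c] c(1) x(2) by simp
        then show False using x(3) commute_E[of x c] by simp
      qed
      then show ?thesis by (rule lift) (rule x(4))
    next
      case all_C: False
      have "(y, z) \<in> E" if "y \<in> ?W" "z \<in> ?W" "y \<noteq> z" for y z
      proof (cases "y \<in> S")
        case True
        then show ?thesis using that S_universal[of y z] by simp
      next
        case False
        then show ?thesis using that all_C by auto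
      qed
      then have "simplicial ?W w" by (simp add: simplicial_def)
      then show ?thesis by (rule lift[OF \<open>w \<in> C\<close>])
    qed
  qed
qed

lemma ex_simplicial:
  assumes "finite W" "W \<noteq> {}"
  shows "\<exists>x\<in>W. simplicial W x"
proof (cases "\<exists>v\<in>W. \<exists>w\<in>W. w \<noteq> v \<and> (v, w) \<notin> E")
  case True
  then show ?thesis using ex_simplicial_nonneighbour[OF assms(1)] by blast
next
  case False
  then have "simplicial W x" if "x \<in> W" for x
    by (simp add: simplicial_def) metis
  then show ?thesis using assms(2) by blast
qed

text \<open>A simplicial vertex \<open>s\<close> is removed, the rest is ordered by induction, and
  \<open>s\<close> is put last: its value \<open>N\<close> exceeds every other value, so the
  condition at \<open>s\<close> is exactly that \<open>s\<close> is simplicial.\<close>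

lemma ex_elimination_ordering:
  assumes "finite W"
  shows "\<exists>r :: 'a \<Rightarrow> nat. inj_on r W \<and> (\<forall>x\<in>W. \<forall>y\<in>W. \<forall>z\<in>W.
    (x, y) \<in> E \<and> (z, y) \<in> E \<and> r x < r y \<and> r z < r y \<and> x \<noteq> z \<longrightarrow> (x, z) \<in> E)"
  using assms
proof (induction W rule: finite_psubset_induct)
  case (psubset W)
  show ?case
  proof (cases "W = {}")
    case False
    then obtain s where s: "s \<in> W" "simplicial W s"
      using ex_simplicial psubset.hyps by blast
    then obtain r :: "'a \<Rightarrow> nat" where inj: "inj_on r (W - {s})"
      and r: "\<And>x y z. \<lbrakk>x \<in> W - {s}; y \<in> W - {s}; z \<in> W - {s}; (x, y) \<in> E; (z, y) \<in> E; r x < r y;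
        r z < r y; x \<noteq> z\<rbrakk> \<Longrightarrow> (x, z) \<in> E"
      using psubset.IH[of "W - {s}"] by blast
    obtain N where N: "\<And>x. x \<in> W \<Longrightarrow> r x < N"
      using psubset.hyps finite_nat_set_iff_bounded[of "r ` W"] by auto
    let ?r = "r(s := N)"
    show ?thesis
    proof (intro exI[of _ ?r] conjI ballI impI)
      show "inj_on ?r W"
      proof (rule inj_onI)
        fix x y assume *: "x \<in> W" "y \<in> W" "?r x = ?r y"
        then show "x = y" using N[of x] N[of y] inj by (auto split: if_splits dest: inj_onD)
      qed
    next
      fix x y z assume W: "x \<in> W" "y \<in> W" "z \<in> W"
        and h: "(x, y) \<in> E \<and> (z, y) \<in> E \<and> ?r x < ?r y \<and> ?r z < ?r y \<and> x \<noteq> z"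
      show "(x, z) \<in> E"
      proof (cases "y = s")
        case True
        then show ?thesis using h W s commute_E unfolding simplicial_def by blast
      next
        case False
        then have "x \<noteq> s" "z \<noteq> s" using h N[of y] W by auto
        then show ?thesis using r[of x y z] W h False by auto
      qed
    qed
  qed auto
qed

end

section \<open>Balls and the elimination ordering of odd powers\<close>

text \<open>Induction on \<open>C\<close>, deleting its \<open>r\<close>-greatest vertex
  \<open>c\<close>. If \<open>c = x\<close>, any neighbour of \<open>x\<close> in \<open>C\<close>
  is smaller, and connectedness provides one. Otherwise \<open>C\<close> stays connected without
  \<open>c\<close>, since the neighbours of \<open>c\<close> are pairwise adjacent and a path can
  bypass it.\<close>

lemma connected_ex_smaller_neighbour:
  fixes F :: "'a rel" and r :: "'a \<Rightarrow> nat"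
  assumes "finite C" "sym F" "irrefl F" "inj_on r C"
    and "\<And>x y z. \<lbrakk>x \<in> C; y \<in> C; z \<in> C; (x, y) \<in> F; (z, y) \<in> F; r x < r y; r z < r y; x \<noteq> z\<rbrakk>
      \<Longrightarrow> (x, z) \<in> F"
    and "\<And>a b. \<lbrakk>a \<in> C; b \<in> C\<rbrakk> \<Longrightarrow> (a, b) \<in> (F \<inter> C \<times> C)\<^sup>*"
    and "x \<in> C" "z \<in> C" "r z < r x"
  shows "\<exists>w\<in>C. (w, x) \<in> F \<and> r w < r x"
  using assms(1,4-)
proof (induction C rule: finite_psubset_induct)
  case (psubset C)
  note inj = psubset.prems(1) and peo = psubset.prems(2) and conn = psubset.prems(3)
  obtain c where c: "c \<in> C" "\<And>y. y \<in> C \<Longrightarrow> r y \<le> r c"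
    using psubset.hyps \<open>x \<in> C\<close> finite_imageI[of C r] Max_in[of "r ` C"] Max_ge[of "r ` C"]
    by (metis (no_types, lifting) empty_iff image_eqI image_iff)
  have below: "r y < r c" if "y \<in> C" "y \<noteq> c" for y
    using that c inj by (metis inj_onD le_neq_implies_less)
  show ?case
  proof (cases "c = x")
    case True
    have "(x, z) \<in> (F \<inter> C \<times> C)\<^sup>*" using conn psubset.prems by blast
    moreover have "x \<noteq> z" using psubset.prems by auto
    ultimately obtain w where "(x, w) \<in> F \<inter> C \<times> C" by (meson converse_rtranclE)
    moreover from this have "w \<noteq> x" using \<open>irrefl F\<close> by (auto simp: irrefl_def)
    ultimately show ?thesis using below True \<open>sym F\<close> by (auto dest: symD)
  next
    case False
    let ?C = "C - {c}" and ?R = "F \<inter> (C - {c}) \<times> (C - {c})"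
    \<comment> \<open>Strengthened for the induction along the walk: when the walk stands at
      \<open>c\<close>, every neighbour of \<open>c\<close> is claimed to be reachable without
      \<open>c\<close>, so whichever one comes next is covered.\<close>
    have conn': "(b \<noteq> c \<longrightarrow> (a, b) \<in> ?R\<^sup>*) \<and> (b = c \<longrightarrow> (\<forall>y\<in>?C. (y, c) \<in> F \<longrightarrow> (a, y) \<in> ?R\<^sup>*))"
      if "(a, b) \<in> (F \<inter> C \<times> C)\<^sup>*" "a \<in> ?C" for a b
      using that(1)
    proof (induction rule: rtrancl_induct)
      case base
      show ?case using that(2) by auto
    next
      case (step b d)
      have bd: "b \<in> C" "d \<in> C" "(b, d) \<in> F" "b \<noteq> d" "(d, b) \<in> F"
        using step.hyps \<open>irrefl F\<close> \<open>sym F\<close> by (auto simp: irrefl_def dest: symD)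
      show ?case
      proof (intro conjI impI ballI)
        assume "d \<noteq> c"
        show "(a, d) \<in> ?R\<^sup>*"
        proof (cases "b = c")
          case True
          then show ?thesis using step.IH bd by auto
        next
          case False
          then have "(b, d) \<in> ?R" using bd \<open>d \<noteq> c\<close> by auto
          then show ?thesis using step.IH False by (meson rtrancl.rtrancl_into_rtrancl)
        qed
      next
        fix y assume "d = c" "y \<in> ?C" "(y, c) \<in> F"
        then have ab: "(a, b) \<in> ?R\<^sup>*" and "b \<noteq> c" using step.IH bd by auto
        show "(a, y) \<in> ?R\<^sup>*"
        proof (cases "b = y")
          case False
          then have "(b, y) \<in> F"
            using peo[of b c y] bd \<open>d = c\<close> \<open>y \<in> ?C\<close> \<open>(y, c) \<in> F\<close> below by auto
          then have "(b, y) \<in> ?R" using \<open>b \<noteq> c\<close> bd \<open>y \<in> ?C\<close> by auto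
          then show ?thesis using ab by (meson rtrancl.rtrancl_into_rtrancl)
        qed (use ab in simp)
      qed
    qed
    have "\<exists>w\<in>?C. (w, x) \<in> F \<and> r w < r x"
    proof (rule psubset.IH)
      show "?C \<subset> C" using c by auto
      show "inj_on r ?C" using inj by (auto intro: inj_on_subset)
      show "(a, b) \<in> ?R\<^sup>*" if "a \<in> ?C" "b \<in> ?C" for a b
        using conn'[of a b] conn that by auto
      show "x \<in> ?C" "z \<in> ?C" using False psubset.prems(4-6) below[of x] by auto
      show "r z < r x" by (fact psubset.prems(6))
      show "(a, b) \<in> F" if "a \<in> ?C" "y \<in> ?C" "b \<in> ?C" "(a, y) \<in> F" "(b, y) \<in> F"
        "r a < r y" "r b < r y" "a \<noteq> b" for a y b
        using peo[of a y b] that by simp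
    qed
    then show ?thesis by auto
  qed
qed

lemma sym_relpow: "sym R \<Longrightarrow> sym (R ^^ n)"
proof (induction n)
  case (Suc n)
  show ?case
  proof (rule symI)
    fix a b assume "(a, b) \<in> R ^^ Suc n"
    then obtain c where "(a, c) \<in> R ^^ n" "(c, b) \<in> R" by auto
    then have "(b, c) \<in> R" "(c, a) \<in> R ^^ n" using Suc by (auto dest: symD)
    then show "(b, a) \<in> R ^^ Suc n" by (rule relpow_Suc_I2)
  qed
qed (auto simp: sym_def)

text \<open>Steps that stay in place turn walks of length exactly \<open>m\<close> into distance at
  most \<open>m\<close>; hence powers of \<open>F \<union> Id\<close> stand for balls
  throughout.\<close>

lemma relpow_reflcl_mono: "m \<le> n \<Longrightarrow> (a, b) \<in> (F \<union> Id) ^^ m \<Longrightarrow> (a, b) \<in> (F \<union> Id) ^^ n"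
  by (induction n rule: dec_induct) auto

text \<open>A walk of length at most \<open>m\<close> from the centre never leaves the ball, because
  the smaller balls are contained in it.\<close>

lemma ball_connected:
  assumes "sym F" "a \<in> ((F \<union> Id) ^^ m) `` {u}"
  shows "(u, a) \<in> (F \<inter> (((F \<union> Id) ^^ m) `` {u}) \<times> (((F \<union> Id) ^^ m) `` {u}))\<^sup>*"
  using assms(2)
proof (induction m arbitrary: a)
  case (Suc m)
  let ?B = "\<lambda>m. ((F \<union> Id) ^^ m) `` {u}"
  have mono: "?B m \<subseteq> ?B (Suc m)" by auto
  from Suc.prems obtain c where c: "c \<in> ?B m" "(c, a) \<in> F \<union> Id" by auto
  have "(u, c) \<in> (F \<inter> ?B m \<times> ?B m)\<^sup>*" using Suc.IH c(1) .
  then have uc: "(u, c) \<in> (F \<inter> ?B (Suc m) \<times> ?B (Suc m))\<^sup>*"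
    using mono by (elim rtrancl_mono[THEN subsetD, rotated]) blast
  have "c \<in> ?B (Suc m)" using c mono by blast
  then have "(c, a) \<in> (F \<inter> ?B (Suc m) \<times> ?B (Suc m)) \<union> Id" using c(2) Suc.prems by blast
  then show ?case using uc by (auto intro: rtrancl_into_rtrancl)
qed auto

lemma odd_power_elimination_ordering:
  fixes F :: "'a rel" and r :: "'a \<Rightarrow> nat" and m :: nat
  defines "B \<equiv> \<lambda>u. ((F \<union> Id) ^^ m) `` {u}"
  assumes W: "finite W" "F \<subseteq> W \<times> W" and F: "sym F" "irrefl F" and inj: "inj_on r W"
    and peo: "\<And>x y z. \<lbrakk>(x, y) \<in> F; (z, y) \<in> F; r x < r y; r z < r y; x \<noteq> z\<rbrakk> \<Longrightarrow> (x, z) \<in> F"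
    and uvw: "u \<in> W" "v \<in> W" "u' \<in> W"
    and le: "Min (r ` B u) \<le> Min (r ` B v)" "Min (r ` B u') \<le> Min (r ` B v)"
    and P: "(u, v) \<in> (F \<union> Id) ^^ Suc (2 * m)" "(u', v) \<in> (F \<union> Id) ^^ Suc (2 * m)"
  shows "(u, u') \<in> (F \<union> Id) ^^ Suc (2 * m)"
proof -
  let ?R = "F \<union> Id"
  have sym_R: "sym ?R" using F by (auto simp: sym_def)
  have BW: "B u \<subseteq> W" if "u \<in> W" for u
  proof
    fix a assume "a \<in> B u"
    then have "(u, a) \<in> ?R ^^ m" by (simp add: B_def)
    then show "a \<in> W"
      by (induction m arbitrary: a) (use that W in auto)
  qed
  have B_refl: "u \<in> B u" for u using relpow_reflcl_mono[of 0 m u u F] by (simp add: B_def)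
  have B_conn: "(u, a) \<in> (F \<inter> B u \<times> B u)\<^sup>*" if "a \<in> B u" for u a
    using ball_connected[OF F(1)] that unfolding B_def .
  have B_fin: "finite (B u)" if "u \<in> W" for u using BW[OF that] W finite_subset by blast
  have B_min: "Min (r ` B u) \<le> r a" if "a \<in> B u" "u \<in> W" for a u
    using that B_fin by simp
  have ex_min: "\<exists>a\<in>B u. r a = Min (r ` B u)" if "u \<in> W" for u
    using Min_in[of "r ` B u"] B_fin[OF that] B_refl[of u] by fastforce
  obtain x where x: "x \<in> B v" "r x = Min (r ` B v)" using ex_min uvw by blast
  have key: "\<exists>w\<in>B u. w = x \<or> (w, x) \<in> F \<and> r w < r x"
    if u: "u \<in> W" and le_u: "Min (r ` B u) \<le> Min (r ` B v)" and P_u: "(u, v) \<in> ?R ^^ Suc (2 * m)" for u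
  proof (cases "x \<in> B u")
    case False
    obtain z where z: "z \<in> B u" "r z = Min (r ` B u)" using ex_min u by blast
    \<comment> \<open>Since \<open>z\<close> lies in \<open>B u\<close> and \<open>x\<close> does
      not, injectivity makes the inequality between the minima strict even when the keys could
      tie.\<close>
    have "r z \<noteq> r x" using inj z x False BW u uvw by (metis inj_onD subsetD)
    then have "r z < r x" using z x le_u by auto
    let ?C = "B u \<union> B v"
    let ?Q = "F \<inter> ?C \<times> ?C"
    \<comment> \<open>Here the exponent is split as \<open>m + 1 + m\<close>: one edge, or a common
      vertex, joins the two balls, so their union is connected.\<close>
    have "(u, v) \<in> ?R ^^ m O ?R O ?R ^^ m"
      using P_u by (metis relpow_add relpow.simps(2) relpow_commute mult_2 O_assoc)
    then obtain a b where ab: "(u, a) \<in> ?R ^^ m" "(a, b) \<in> ?R" "(b, v) \<in> ?R ^^ m" by auto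
    then have "a \<in> B u" "b \<in> B v" using sym_relpow[OF sym_R] by (auto simp: B_def dest: symD)
    have mono: "(F \<inter> B y \<times> B y)\<^sup>* \<subseteq> ?Q\<^sup>*" if "y = u \<or> y = v" for y
      using that by (intro rtrancl_mono) auto
    have from_u: "(u, c) \<in> ?Q\<^sup>*" if "c \<in> B u" for c using B_conn[OF that] mono by blast
    have from_v: "(v, c) \<in> ?Q\<^sup>*" if "c \<in> B v" for c using B_conn[OF that] mono by blast
    have sym_Q: "sym (?Q\<^sup>*)" by (rule sym_rtrancl) (use F in \<open>auto simp: sym_def\<close>)
    have "(a, b) \<in> ?Q\<^sup>*" using ab(2) \<open>a \<in> B u\<close> \<open>b \<in> B v\<close> by auto
    then have "(u, v) \<in> ?Q\<^sup>*"
      using from_u[OF \<open>a \<in> B u\<close>] symD[OF sym_Q from_v[OF \<open>b \<in> B v\<close>]] by (meson rtrancl_trans)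
    then have from_u': "(u, c) \<in> ?Q\<^sup>*" if "c \<in> ?C" for c
      using that from_u from_v by (meson UnE rtrancl_trans)
    have C_conn: "(c, d) \<in> ?Q\<^sup>*" if "c \<in> ?C" "d \<in> ?C" for c d
      using symD[OF sym_Q from_u'[OF that(1)]] from_u'[OF that(2)] by (meson rtrancl_trans)
    have "\<exists>w\<in>?C. (w, x) \<in> F \<and> r w < r x"
    proof (rule connected_ex_smaller_neighbour[of ?C F r x z])
      show "finite ?C" using B_fin u uvw by auto
      show "inj_on r ?C" using inj by (rule inj_on_subset) (use BW u uvw in auto)
      show "x \<in> ?C" "z \<in> ?C" using x z by auto
      show "(a, b) \<in> F" if "(a, y) \<in> F" "(b, y) \<in> F" "r a < r y" "r b < r y" "a \<noteq> b" for a y b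
        using peo that .
    qed (fact F C_conn \<open>r z < r x\<close>)+
    then obtain w where w: "w \<in> ?C" "(w, x) \<in> F" "r w < r x" by blast
    \<comment> \<open>As \<open>x\<close> is minimal on \<open>B v\<close>, a smaller vertex of the
      union can only come from \<open>B u\<close>.\<close>
    then have "w \<notin> B v" using B_min[of w v] uvw x by auto
    then show ?thesis using w by auto
  qed auto
  obtain w where w: "w \<in> B u" "w = x \<or> (w, x) \<in> F \<and> r w < r x" using key[of u] uvw le P by blast
  obtain w' where w': "w' \<in> B u'" "w' = x \<or> (w', x) \<in> F \<and> r w' < r x" using key[of u'] uvw le P by blast
  \<comment> \<open>Both vertices are \<open>x\<close> or earlier neighbours of \<open>x\<close>,
    and earlier neighbours are pairwise adjacent.\<close>
  have "(w, w') \<in> ?R" using w w' peo[of w x w'] F(1) by (auto dest: symD)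
  moreover have "(w', u') \<in> ?R ^^ m" using w' sym_relpow[OF sym_R] by (auto simp: B_def dest: symD)
  ultimately have "(u, u') \<in> ?R ^^ m O ?R O ?R ^^ m" using w by (auto simp: B_def)
  then show ?thesis by (metis relpow_add relpow.simps(2) relpow_commute mult_2 O_assoc)
qed

section \<open>Greedy colouring and compactness\<close>

text \<open>A vertex \<open>v\<close> with the largest key is coloured last. Its neighbours are
  pairwise adjacent and form a clique together with \<open>v\<close>, so there are at most
  \<open>n - 1\<close> of them and one of the \<open>n\<close> colours is free.\<close>

lemma greedy_colouring:
  fixes k :: "'a \<Rightarrow> nat"
  assumes "finite A" "sym P"
    and "\<And>u v u'. \<lbrakk>u \<in> A; v \<in> A; u' \<in> A; k u \<le> k v; k u' \<le> k v; (u, v) \<in> P; (u', v) \<in> P\<rbrakk> \<Longrightarrow> (u, u') \<in> P"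
    and "\<And>S. \<lbrakk>S \<subseteq> A; \<forall>u\<in>S. \<forall>v\<in>S. u \<noteq> v \<longrightarrow> (u, v) \<in> P\<rbrakk> \<Longrightarrow> card S \<le> n"
  shows "\<exists>f. f ` A \<subseteq> {1..n} \<and> (\<forall>u\<in>A. \<forall>v\<in>A. u \<noteq> v \<and> (u, v) \<in> P \<longrightarrow> f u \<noteq> (f v :: nat))"
  using assms(1,3,4)
proof (induction A rule: finite_psubset_induct)
  case (psubset A)
  note elim = psubset.prems(1) and clique = psubset.prems(2)
  show ?case
  proof (cases "A = {}")
    case False
    then obtain v where v: "v \<in> A" "\<And>u. u \<in> A \<Longrightarrow> k u \<le> k v"
      using psubset.hyps finite_imageI[of A k] Max_in[of "k ` A"] Max_ge[of "k ` A"]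
      by (metis (no_types, lifting) image_eqI image_iff image_is_empty)
    have "\<exists>f. f ` (A - {v}) \<subseteq> {1..n} \<and>
        (\<forall>u\<in>A - {v}. \<forall>w\<in>A - {v}. u \<noteq> w \<and> (u, w) \<in> P \<longrightarrow> f u \<noteq> (f w :: nat))"
    proof (rule psubset.IH)
      show "A - {v} \<subset> A" using v by auto
      show "(a, c) \<in> P" if "a \<in> A - {v}" "b \<in> A - {v}" "c \<in> A - {v}" "k a \<le> k b" "k c \<le> k b"
        "(a, b) \<in> P" "(c, b) \<in> P" for a b c
        using elim[of a b c] that by simp
      show "card S \<le> n" if "S \<subseteq> A - {v}" "\<forall>u\<in>S. \<forall>v\<in>S. u \<noteq> v \<longrightarrow> (u, v) \<in> P" for S
        by (rule clique) (use that in auto)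
    qed
    then obtain f :: "'a \<Rightarrow> nat" where f: "f ` (A - {v}) \<subseteq> {1..n}"
      "\<forall>u\<in>A - {v}. \<forall>w\<in>A - {v}. u \<noteq> w \<and> (u, w) \<in> P \<longrightarrow> f u \<noteq> f w" by (elim exE conjE)
    define N where "N = {u \<in> A - {v}. (u, v) \<in> P}"
    have "finite N" using psubset.hyps by (simp add: N_def)
    have "card (insert v N) \<le> n"
    proof (rule clique)
      show "insert v N \<subseteq> A" using v by (auto simp: N_def)
      have "(a, b) \<in> P" if "a \<in> N" "b \<in> N" for a b
        using elim[of a v b] that v by (simp add: N_def)
      moreover have "(a, v) \<in> P" "(v, a) \<in> P" if "a \<in> N" for a
        using that \<open>sym P\<close> by (auto simp: N_def dest: symD)
      ultimately show "\<forall>a\<in>insert v N. \<forall>b\<in>insert v N. a \<noteq> b \<longrightarrow> (a, b) \<in> P" by simp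
    qed
    then have "card (f ` N) < card {1..n}"
      using card_image_le[OF \<open>finite N\<close>, of f] \<open>finite N\<close> by (simp add: N_def)
    then have "\<not> {1..n} \<subseteq> f ` N"
      using \<open>finite N\<close> by (meson card_mono finite_imageI leD)
    then obtain c where c: "c \<in> {1..n}" "c \<notin> f ` N" by blast
    have "\<forall>u\<in>A. \<forall>w\<in>A. u \<noteq> w \<and> (u, w) \<in> P \<longrightarrow> (f(v := c)) u \<noteq> (f(v := c)) w"
      using f(2) c(2) \<open>sym P\<close> by (auto simp: N_def dest: symD)
    moreover have "(f(v := c)) ` A \<subseteq> {1..n}" using f(1) c(1) by auto
    ultimately show ?thesis by blast
  qed auto
qed

text \<open>Maps from \<open>V\<close> to the finite discrete space \<open>K\<close> form a compact
  product. Separating the ends of one edge is a closed condition, and finitely many such conditions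
  can be met together by hypothesis.\<close>

lemma de_Bruijn_Erdos:
  fixes V :: "'a set" and P :: "'a rel" and K :: "'c set"
  assumes "finite K"
    and "\<And>A. \<lbrakk>finite A; A \<subseteq> V\<rbrakk> \<Longrightarrow>
      \<exists>f. f ` A \<subseteq> K \<and> (\<forall>u\<in>A. \<forall>v\<in>A. u \<noteq> v \<and> (u, v) \<in> P \<longrightarrow> f u \<noteq> f v)"
  shows "\<exists>f. f ` V \<subseteq> K \<and> (\<forall>u\<in>V. \<forall>v\<in>V. u \<noteq> v \<and> (u, v) \<in> P \<longrightarrow> f u \<noteq> f v)"
proof (cases "V = {}")
  case False
  let ?X = "product_topology (\<lambda>_. discrete_topology K) V"
  define D where "D = (\<lambda>(u, v). {f \<in> topspace ?X. f u \<noteq> f v})"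
  define Q where "Q = {(u, v). u \<in> V \<and> v \<in> V \<and> u \<noteq> v \<and> (u, v) \<in> P}"
  have top: "topspace ?X = V \<rightarrow>\<^sub>E K" by simp
  have compact: "compact_space ?X"
    by (simp add: compact_space_product_topology compact_space_discrete_topology \<open>finite K\<close>)
  have closed: "closedin ?X (D e)" if "e \<in> Q" for e
  proof -
    obtain u v where e: "e = (u, v)" "u \<in> V" "v \<in> V" using \<open>e \<in> Q\<close> by (auto simp: Q_def)
    have pre: "closedin ?X {f \<in> topspace ?X. f w \<in> {c}}" if "w \<in> V" "c \<in> K" for w c
      by (rule closedin_continuous_map_preimage[OF continuous_map_product_projection[OF that(1)]])
        (use that in simp)
    \<comment> \<open>Closedness comes from a finite union over the pairs of distinct colours that
      the two ends may receive.\<close>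
    have "D e = (\<Union>(a, b) \<in> {(a, b) \<in> K \<times> K. a \<noteq> b}.
        {f \<in> topspace ?X. f u \<in> {a}} \<inter> {f \<in> topspace ?X. f v \<in> {b}})"
      using e unfolding D_def top by (auto simp: PiE_iff)
    also have "closedin ?X \<dots>"
      by (rule closedin_Union) (use \<open>finite K\<close> pre e in \<open>auto intro!: closedin_Int
        finite_subset[OF _ finite_cartesian_product[OF \<open>finite K\<close> \<open>finite K\<close>]]\<close>)
    finally show ?thesis .
  qed
  have top_nonempty: "topspace ?X \<noteq> {}"
  proof -
    have "K \<noteq> {}" using assms(2)[of "{SOME v. v \<in> V}"] False some_in_eq by fastforce
    then show ?thesis by (simp add: PiE_eq_empty_iff)
  qed
  \<comment> \<open>The whole space is added to the family so that a common element is a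
    \<open>K\<close>-valued map even when there are no edges.\<close>
  have fip: "\<Inter>\<F> \<noteq> {}" if \<F>: "finite \<F>" "\<F> \<subseteq> insert (topspace ?X) (D ` Q)" for \<F>
  proof -
    obtain Q' where Q': "finite Q'" "Q' \<subseteq> Q" "\<F> - {topspace ?X} = D ` Q'"
    proof -
      have "finite (\<F> - {topspace ?X})" "\<F> - {topspace ?X} \<subseteq> D ` Q" using \<F> by auto
      from finite_subset_image[OF this] show ?thesis using that by metis
    qed
    define A where "A = fst ` Q' \<union> snd ` Q'"
    have "A \<subseteq> V" "finite A" using Q' by (auto simp: A_def Q_def)
    from assms(2)[OF this(2,1)] obtain f
      where f: "f ` A \<subseteq> K" "\<forall>u\<in>A. \<forall>v\<in>A. u \<noteq> v \<and> (u, v) \<in> P \<longrightarrow> f u \<noteq> f v"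
      by (elim exE conjE)
    obtain g where g: "g \<in> V \<rightarrow>\<^sub>E K" using top_nonempty top by auto
    \<comment> \<open>The colouring \<open>f\<close> is controlled only on \<open>A\<close>;
      elsewhere an arbitrary point \<open>g\<close> of the product supplies the values.\<close>
    define h where "h = (\<lambda>v. if v \<in> A then f v else g v)"
    have h: "h \<in> topspace ?X"
      using f g \<open>A \<subseteq> V\<close> unfolding top h_def by (fastforce simp: PiE_iff extensional_def)
    have "h \<in> D e" if "e \<in> Q'" for e
    proof -
      obtain u v where e: "e = (u, v)" by fastforce
      have "(u, v) \<in> Q" using that e Q'(2) by auto
      moreover have "u \<in> A" "v \<in> A" unfolding A_def using that e by (auto intro: rev_image_eqI)
      ultimately have "f u \<noteq> f v" using f(2) by (simp add: Q_def)
      then show ?thesis using e h \<open>u \<in> A\<close> \<open>v \<in> A\<close> by (simp add: D_def h_def)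
    qed
    then have "h \<in> B" if "B \<in> \<F>" for B
      using Q'(3) h that by (cases "B = topspace ?X") (simp, blast)
    then show ?thesis by blast
  qed
  have "\<Inter>(insert (topspace ?X) (D ` Q)) \<noteq> {}"
  proof (rule compact[unfolded compact_space_fip, rule_format])
    show "(\<forall>B\<in>insert (topspace ?X) (D ` Q). closedin ?X B) \<and>
        (\<forall>\<F>. finite \<F> \<and> \<F> \<subseteq> insert (topspace ?X) (D ` Q) \<longrightarrow> \<Inter>\<F> \<noteq> {})"
    proof (intro conjI ballI allI impI)
      show "closedin ?X B" if "B \<in> insert (topspace ?X) (D ` Q)" for B
        using that closed by (elim insertE imageE) (simp_all del: topspace_product_topology)
      show "\<Inter>\<F> \<noteq> {}" if "finite \<F> \<and> \<F> \<subseteq> insert (topspace ?X) (D ` Q)" for \<F>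
        using fip that by simp
    qed
  qed
  then obtain f where "f \<in> \<Inter>(insert (topspace ?X) (D ` Q))" by (meson ex_in_conv)
  then have f: "f \<in> topspace ?X" "\<And>e. e \<in> Q \<Longrightarrow> f \<in> D e" by simp_all
  have "f ` V \<subseteq> K" using f(1) unfolding top by auto
  moreover have "f u \<noteq> f v" if "u \<in> V" "v \<in> V" "u \<noteq> v" "(u, v) \<in> P" for u v
    using f(2)[of "(u, v)"] that by (auto simp: Q_def D_def)
  ultimately show ?thesis by blast
qed auto

section \<open>Colouring odd powers of possibly infinite chordal relations\<close>

lemma relpow_reflcl_subset_mono:
  "F \<subseteq> F' \<Longrightarrow> (F \<union> Id) ^^ d \<subseteq> (F' \<union> Id) ^^ d"
  by (induction d) (auto intro!: relcomp_mono)

text \<open>A single walk witnessing the distance visits only finitely many vertices; these are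
  collected in \<open>W\<close>.\<close>

lemma relpow_reflcl_finite_support:
  "(u, v) \<in> (E \<union> Id) ^^ d \<Longrightarrow> \<exists>W. finite W \<and> (u, v) \<in> (E \<inter> W \<times> W \<union> Id) ^^ d"
proof (induction d arbitrary: v)
  case (Suc d)
  then obtain w where w: "(u, w) \<in> (E \<union> Id) ^^ d" "(w, v) \<in> E \<union> Id" by auto
  with Suc.IH obtain W where W: "finite W" "(u, w) \<in> (E \<inter> W \<times> W \<union> Id) ^^ d" by blast
  let ?W = "insert w (insert v W)"
  have "(u, w) \<in> (E \<inter> ?W \<times> ?W \<union> Id) ^^ d"
    using W(2) relpow_reflcl_subset_mono[of "E \<inter> W \<times> W" "E \<inter> ?W \<times> ?W" d] by auto
  moreover have "(w, v) \<in> E \<inter> ?W \<times> ?W \<union> Id" using w(2) by auto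
  ultimately have "(u, v) \<in> (E \<inter> ?W \<times> ?W \<union> Id) ^^ Suc d" by (rule relpow_Suc_I)
  then show ?case using W(1) by (metis finite.insertI)
qed auto

context chordal_relation
begin

text \<open>
  The set \<open>W\<close> adds to \<open>A\<close> the vertices of walks witnessing all short distances within \<open>A\<close>, so the
  power restricted to \<open>A\<close> can be computed in the finite graph induced on \<open>W\<close>.
\<close>

lemma odd_power_colouring_finite:
  assumes "odd d" "finite A"
    and clique: "\<And>S. \<lbrakk>finite S; S \<subseteq> A; \<forall>u\<in>S. \<forall>v\<in>S. u \<noteq> v \<longrightarrow> (u, v) \<in> (E \<union> Id) ^^ d\<rbrakk> \<Longrightarrow> card S \<le> n"
  shows "\<exists>f. f ` A \<subseteq> {1..n} \<and>
    (\<forall>u\<in>A. \<forall>v\<in>A. u \<noteq> v \<and> (u, v) \<in> (E \<union> Id) ^^ d \<longrightarrow> f u \<noteq> (f v :: nat))"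
proof -
  obtain m where d: "d = Suc (2 * m)" using \<open>odd d\<close> by (auto elim: oddE)
  define Q where "Q = {e \<in> A \<times> A. e \<in> (E \<union> Id) ^^ d}"
  have "\<forall>e\<in>Q. \<exists>W. finite W \<and> e \<in> (E \<inter> W \<times> W \<union> Id) ^^ d"
    using relpow_reflcl_finite_support by (fastforce simp: Q_def)
  then obtain S where S: "\<And>e. e \<in> Q \<Longrightarrow> finite (S e) \<and> e \<in> (E \<inter> S e \<times> S e \<union> Id) ^^ d" by metis
  define W where "W = A \<union> (\<Union>e\<in>Q. S e)"
  define F where "F = E \<inter> W \<times> W"
  define P where "P = (F \<union> Id) ^^ d"
  have "finite Q" using \<open>finite A\<close> by (simp add: Q_def)
  then have "finite W" using S \<open>finite A\<close> by (auto simp: W_def)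
  have P_iff: "(u, v) \<in> P \<longleftrightarrow> (u, v) \<in> (E \<union> Id) ^^ d" if "u \<in> A" "v \<in> A" for u v
  proof
    show "(u, v) \<in> P \<Longrightarrow> (u, v) \<in> (E \<union> Id) ^^ d"
      using relpow_reflcl_subset_mono[of F E d] by (auto simp: P_def F_def)
    assume "(u, v) \<in> (E \<union> Id) ^^ d"
    then have uv: "(u, v) \<in> Q" using that by (simp add: Q_def)
    then have "E \<inter> S (u, v) \<times> S (u, v) \<subseteq> F" by (auto simp: F_def W_def)
    from relpow_reflcl_subset_mono[OF this, of d] show "(u, v) \<in> P"
      using S[OF uv] by (auto simp: P_def)
  qed
  have F: "sym F" "irrefl F" "F \<subseteq> W \<times> W"
    using sym_E irrefl_E by (auto simp: F_def sym_def irrefl_def)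
  obtain r :: "'a \<Rightarrow> nat" where inj: "inj_on r W"
    and r: "\<forall>x\<in>W. \<forall>y\<in>W. \<forall>z\<in>W.
      (x, y) \<in> E \<and> (z, y) \<in> E \<and> r x < r y \<and> r z < r y \<and> x \<noteq> z \<longrightarrow> (x, z) \<in> E"
    using ex_elimination_ordering[OF \<open>finite W\<close>] by (elim exE conjE)
  have peo: "(x, z) \<in> F" if "(x, y) \<in> F" "(z, y) \<in> F" "r x < r y" "r z < r y" "x \<noteq> z" for x y z
    using r[rule_format, of x y z] that by (simp add: F_def)
  have "A \<subseteq> W" by (auto simp: W_def)
  have "\<exists>f. f ` A \<subseteq> {1..n} \<and> (\<forall>u\<in>A. \<forall>v\<in>A. u \<noteq> v \<and> (u, v) \<in> P \<longrightarrow> f u \<noteq> (f v :: nat))"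
  \<comment> \<open>The balls are those of the finite relation \<open>F\<close>, so the minima
    exist; the elimination property holds on \<open>W\<close> and is used only for vertices of
    \<open>A\<close>.\<close>
  proof (rule greedy_colouring[where k = "\<lambda>u. Min (r ` (((F \<union> Id) ^^ m) `` {u}))"])
    show "sym P" unfolding P_def by (rule sym_relpow) (use F(1) in \<open>auto simp: sym_def\<close>)
    show "card S \<le> n" if "S \<subseteq> A" "\<forall>u\<in>S. \<forall>v\<in>S. u \<noteq> v \<longrightarrow> (u, v) \<in> P" for S
    proof (rule clique)
      show "finite S" using that(1) \<open>finite A\<close> finite_subset by blast
      show "\<forall>u\<in>S. \<forall>v\<in>S. u \<noteq> v \<longrightarrow> (u, v) \<in> (E \<union> Id) ^^ d"
        using that(2) P_iff subsetD[OF that(1)] by simp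
    qed (fact that(1))
    show "(u, u') \<in> P" if "u \<in> A" "v \<in> A" "u' \<in> A"
      "Min (r ` (((F \<union> Id) ^^ m) `` {u})) \<le> Min (r ` (((F \<union> Id) ^^ m) `` {v}))"
      "Min (r ` (((F \<union> Id) ^^ m) `` {u'})) \<le> Min (r ` (((F \<union> Id) ^^ m) `` {v}))"
      "(u, v) \<in> P" "(u', v) \<in> P" for u v u'
      using odd_power_elimination_ordering[where u = u and v = v and u' = u' and m = m,
          OF \<open>finite W\<close> F(3,1,2) inj peo] that subsetD[OF \<open>A \<subseteq> W\<close>]
      unfolding P_def d by simp
  qed (fact \<open>finite A\<close>)
  then show ?thesis using P_iff by simp
qed

lemma odd_power_colouring:
  assumes "odd d"
    and clique: "\<And>S. \<lbrakk>finite S; S \<subseteq> V; \<forall>u\<in>S. \<forall>v\<in>S. u \<noteq> v \<longrightarrow> (u, v) \<in> (E \<union> Id) ^^ d\<rbrakk> \<Longrightarrow> card S \<le> n"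
  shows "\<exists>f. f ` V \<subseteq> {1..n} \<and>
    (\<forall>u\<in>V. \<forall>v\<in>V. u \<noteq> v \<and> (u, v) \<in> (E \<union> Id) ^^ d \<longrightarrow> f u \<noteq> (f v :: nat))"
proof (rule de_Bruijn_Erdos)
  fix A assume A: "finite A" "A \<subseteq> V"
  show "\<exists>f. f ` A \<subseteq> {1..n} \<and>
    (\<forall>u\<in>A. \<forall>v\<in>A. u \<noteq> v \<and> (u, v) \<in> (E \<union> Id) ^^ d \<longrightarrow> f u \<noteq> f v)"
    by (rule odd_power_colouring_finite[OF \<open>odd d\<close> A(1)], rule clique) (use A in auto)
qed simp

end

section \<open>Shortest paths and powers of the adjacency relation\<close>

context pair_wf_digraph
begin

lemma awalk_vwalk_arcs:
  assumes "vwalk p G"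
  shows "awalk (hd p) (vwalk_arcs p) (last p)"
  using assms by (induction) (auto simp: awalk_simps wellformed')

lemma graph_dist_le:
  assumes "vwalk p G"
  shows "graph_dist G (hd p) (last p) \<le> ereal (real (vwalk_length p))"
  using min_cost_le_walk_cost[OF awalk_vwalk_arcs[OF assms], of "\<lambda>_. 1"]
  by (simp add: graph_dist_def awalk_cost_def sum_list_triv vwalk_length_def del: vwalk_length_simp)

text \<open>The distance is an infimum over arc walks. Each arc walk yields a vertex walk of the
  same length, so a lower bound for vertex walks suffices; without any walk the infimum is
  infinite.\<close>

lemma graph_dist_ge:
  assumes "\<And>q. \<lbrakk>vwalk q G; hd q = u; last q = v\<rbrakk> \<Longrightarrow> l \<le> vwalk_length q"
  shows "ereal (real l) \<le> graph_dist G u v"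
  unfolding graph_dist_def \<mu>_def
proof (rule INF_greatest)
  fix p assume "p \<in> {p. awalk u p v}"
  then have p: "awalk u p v" by simp
  have "length (awalk_verts u p) = Suc (length p)" by (induction p arbitrary: u) auto
  then have "l \<le> length p"
    using assms[OF awalk_imp_vwalk[OF p]] p by simp
  then show "ereal (real l) \<le> ereal (awalk_cost (\<lambda>_. 1) p)"
    by (simp add: awalk_cost_def sum_list_triv)
qed

lemma ex_vwalk_of_relpow:
  assumes "u \<in> pverts G" "(u, v) \<in> (parcs G \<union> Id) ^^ d"
  shows "\<exists>p. vwalk p G \<and> hd p = u \<and> last p = v \<and> vwalk_length p \<le> d"
  using assms(2)
proof (induction d arbitrary: v)
  case 0
  then show ?case using assms(1) by (intro exI[of _ "[u]"]) auto
next
  case (Suc d)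
  then obtain w where w: "(u, w) \<in> (parcs G \<union> Id) ^^ d" "(w, v) \<in> parcs G \<union> Id" by auto
  with Suc.IH obtain p where p: "vwalk p G" "hd p = u" "last p = w" "vwalk_length p \<le> d" by blast
  show ?case
  proof (cases "w = v")
    case True
    then show ?thesis using p by (intro exI[of _ p]) simp
  next
    case False
    then have "(w, v) \<in> parcs G" using w by simp
    then show ?thesis using p
      by (intro exI[of _ "p @ [v]"]) (auto simp: vwalk_def vwalk_arcs_append wellformed')
  qed
qed

end

text \<open>The part of the walk between the two vertices connects them; symmetry of
  \<open>E\<close> covers both orders, and \<open>Id\<close> pads to the full length.\<close>

lemma relpow_of_vwalk:
  assumes "sym E" "set (vwalk_arcs p) \<subseteq> E" "u \<in> set p" "v \<in> set p"
  shows "(u, v) \<in> (E \<union> Id) ^^ (length p - 1)"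
  using assms(2-)
proof (induction p arbitrary: u v rule: vwalk_arcs.induct)
  case (3 x y xs)
  have sym: "sym ((E \<union> Id) ^^ n)" for n
    by (rule sym_relpow) (use \<open>sym E\<close> in \<open>auto simp: sym_def\<close>)
  have from_x: "(x, w) \<in> (E \<union> Id) ^^ (length (y # xs))" if "w \<in> set (y # xs)" for w
    using relpow_Suc_I2[of x y "E \<union> Id" w "length xs"] 3 that by simp
  have "(x, x) \<in> (E \<union> Id) ^^ (length (y # xs))"
    by (rule relpow_reflcl_mono[of 0]) simp_all
  moreover have "(u, v) \<in> (E \<union> Id) ^^ (length (y # xs))" if "u \<in> set (y # xs)" "v \<in> set (y # xs)"
    using relpow_reflcl_mono[OF _ 3(1)[OF _ that]] 3(2) by simp
  ultimately show ?case
    using 3(3,4) from_x symD[OF sym from_x] by auto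
qed (auto)

context pair_sym_digraph
begin

lemma sym_parcs: "sym (parcs G)"
  using arcs_symmetric by (auto simp: sym_def)

text \<open>A walk of least length exists, and shortening it to an induced one makes its vertices
  distinct, as a path requires, without making it longer.\<close>

lemma ex_shortest_path:
  assumes "u \<in> pverts G" "(u, v) \<in> (parcs G \<union> Id) ^^ d"
  shows "\<exists>p. shortest_path G p \<and> vwalk_length p \<le> d \<and> {u, v} \<subseteq> set p"
proof -
  let ?walk = "\<lambda>p. vwalk p G \<and> hd p = u \<and> last p = v"
  obtain p0 where p0: "?walk p0" "vwalk_length p0 \<le> d" using ex_vwalk_of_relpow[OF assms] by blast
  obtain p where p: "?walk p" "\<And>q. ?walk q \<Longrightarrow> vwalk_length p \<le> vwalk_length q"
    using ex_has_least_nat[of ?walk p0 vwalk_length] p0 by blast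
  have "p \<noteq> []" "set (vwalk_arcs p) \<subseteq> parcs G" using p by (auto simp: vwalk_def)
  from induced_vwalk[OF this sym_parcs] obtain q where q: "q \<noteq> []" "hd q = hd p" "last q = last p"
    "set q \<subseteq> set p" "distinct q" "set (vwalk_arcs q) \<subseteq> parcs G" by blast
  then have walk_q: "?walk q" using p by (auto simp: vwalk_def)
  \<comment> \<open>The vertices of \<open>q\<close> are distinct and all lie on \<open>p\<close>,
    so counting them bounds the length.\<close>
  have "length q \<le> length p"
    using q(4,5) by (metis List.finite_set card_length card_mono distinct_card order_trans)
  then have len: "vwalk_length q \<le> vwalk_length r" if "?walk r" for r
    using p(2)[OF that] by simp
  have "graph_dist G u v = ereal (real (vwalk_length q))"
    using graph_dist_le[of q] graph_dist_ge[of u v "vwalk_length q"] walk_q len by (auto intro: antisym)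
  then have "shortest_path G q"
    using walk_q q(5) by (simp add: shortest_path_def vpath_def)
  moreover have "{u, v} \<subseteq> set q" using walk_q q(1) by auto
  ultimately show ?thesis using len[OF p0(1)] p0(2) by (meson order_trans)
qed

lemma relpow_of_shortest_path:
  assumes "shortest_path G p" "vwalk_length p \<le> d" "u \<in> set p" "v \<in> set p"
  shows "(u, v) \<in> (parcs G \<union> Id) ^^ d"
proof -
  have "set (vwalk_arcs p) \<subseteq> parcs G"
    using assms(1) by (auto simp: shortest_path_def vpath_def vwalk_def)
  from relpow_of_vwalk[OF sym_parcs this assms(3,4)] show ?thesis
    using assms(2) relpow_reflcl_mono by simp
qed

text \<open>Two vertices share a shortest path of length at most \<open>d\<close> exactly when their
  distance is at most \<open>d\<close>; so these are the cliques of the \<open>d\<close>-th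
  power.\<close>

lemma kd_clique_2_iff:
  "kd_clique 2 d G S \<longleftrightarrow> S \<subseteq> pverts G \<and>
    (\<forall>u\<in>S. \<forall>v\<in>S. u \<noteq> v \<longrightarrow> (u, v) \<in> (parcs G \<union> Id) ^^ d)"
proof (intro iffI conjI ballI impI)
  fix u v assume "kd_clique 2 d G S" "u \<in> S" "v \<in> S" "u \<noteq> v"
  then have "\<exists>p. shortest_path G p \<and> vwalk_length p \<le> d \<and> {u, v} \<subseteq> set p"
    unfolding kd_clique_def by (metis card_2_iff empty_subsetI finite.emptyI finite.insertI insert_subset)
  then show "(u, v) \<in> (parcs G \<union> Id) ^^ d" using relpow_of_shortest_path by auto
next
  assume S: "S \<subseteq> pverts G \<and> (\<forall>u\<in>S. \<forall>v\<in>S. u \<noteq> v \<longrightarrow> (u, v) \<in> (parcs G \<union> Id) ^^ d)"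
  have "\<exists>p. shortest_path G p \<and> vwalk_length p \<le> d \<and> T \<subseteq> set p" if T: "T \<subseteq> S" "card T = 2" for T
  proof -
    obtain u v where "T = {u, v}" "u \<noteq> v" using T(2) by (auto simp: card_2_iff)
    then show ?thesis using ex_shortest_path[of u v d] S T(1) by auto
  qed
  then show "kd_clique 2 d G S" using S by (simp add: kd_clique_def)
qed (auto simp: kd_clique_def)

lemma kd_independent_2_iff:
  "kd_independent 2 d G S \<longleftrightarrow> S \<subseteq> pverts G \<and>
    (\<forall>u\<in>S. \<forall>v\<in>S. u \<noteq> v \<longrightarrow> (u, v) \<notin> (parcs G \<union> Id) ^^ d)"
proof (intro iffI conjI ballI impI notI)
  fix u v assume S: "kd_independent 2 d G S" "u \<in> S" "v \<in> S" "u \<noteq> v"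
    and "(u, v) \<in> (parcs G \<union> Id) ^^ d"
  then obtain p where p: "shortest_path G p" "vwalk_length p \<le> d" "{u, v} \<subseteq> set p"
    using ex_shortest_path[of u v d] by (auto simp: kd_independent_def)
  then have "card (set p \<inter> S) < 2" using S(1) by (simp add: kd_independent_def)
  moreover have "card {u, v} \<le> card (set p \<inter> S)" using p S by (intro card_mono) auto
  ultimately show False using S by simp
next
  assume S: "S \<subseteq> pverts G \<and> (\<forall>u\<in>S. \<forall>v\<in>S. u \<noteq> v \<longrightarrow> (u, v) \<notin> (parcs G \<union> Id) ^^ d)"
  have "card (set p \<inter> S) < 2" if p: "shortest_path G p" "vwalk_length p \<le> d" for p
  proof (rule ccontr)
    assume "\<not> card (set p \<inter> S) < 2"
    then obtain u v where uv: "u \<in> set p \<inter> S" "v \<in> set p \<inter> S" "u \<noteq> v"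
      by (metis List.finite_set card_le_Suc0_iff_eq finite_Int less_2_cases_iff not_less_eq_eq
          numeral_2_eq_2 not_less)
    then have "(u, v) \<in> (parcs G \<union> Id) ^^ d" using relpow_of_shortest_path[OF p] by simp
    then show False using S uv by simp
  qed
  then show "kd_independent 2 d G S" using S by (simp add: kd_independent_def)
qed (auto simp: kd_independent_def)

end

section \<open>Induced subgraphs of chordal graphs and perfectness\<close>

text \<open>A cycle of \<open>H\<close> is a cycle of \<open>G\<close>; its chord in
  \<open>G\<close> has both ends in \<open>H\<close> and so belongs to the induced subgraph
  \<open>H\<close>. Most of the proof translates the closed vertex list into the arc list of a
  cycle.\<close>

lemma chordal_relation_induced_subgraph:
  assumes G: "simple_graph G" "chordal G" and H: "induced_subgraph (with_proj H) (with_proj G)"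
  shows "pair_sym_digraph H" "chordal_relation (parcs H)"
proof -
  interpret G: pair_bidirected_digraph G using G(1) by (simp add: simple_graph_def)
  have verts: "pverts H \<subseteq> pverts G" and arcs: "parcs H = {e \<in> parcs G. fst e \<in> pverts H \<and> snd e \<in> pverts H}"
    using H by (auto simp: induced_subgraph_def subgraph_def)
  show "pair_sym_digraph H"
    by unfold_locales (use arcs G.arcs_symmetric in \<open>auto simp: symmetric_def sym_def\<close>)
  show "chordal_relation (parcs H)"
  proof
    show "sym (parcs H)" using arcs G.arcs_symmetric by (auto simp: sym_def)
    show "irrefl (parcs H)" using arcs G.no_loops' by (auto simp: irrefl_def)
    fix p :: "'a list"
    assume p: "distinct p" "4 \<le> length p" "set (vwalk_arcs (p @ [hd p])) \<subseteq> parcs H"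
    let ?c = "vwalk_arcs (p @ [hd p])"
    have ne: "p \<noteq> []" using p(2) by auto
    have c_G: "set ?c \<subseteq> parcs G" using p(3) arcs by auto
    have len: "length ?c = length p" using vwalk_length_simp[of "p @ [hd p]"]
      by (simp add: vwalk_length_def del: vwalk_length_simp)
    have tails: "map fst ?c = p"
    proof -
      have "map fst (vwalk_arcs (q @ [z])) = q" for q and z :: 'a
        by (induction q rule: vwalk_arcs.induct) auto
      then show ?thesis .
    qed
    have set_p: "fst ` set ?c = set p" using tails by (metis set_map)
    have "fst ` set ?c \<subseteq> pverts H" using p(3) arcs by auto
    then have verts_H: "set p \<subseteq> pverts H" using set_p by simp
    have "vwalk (p @ [hd p]) G"
      using c_G verts_H verts ne subsetD[OF verts_H hd_in_set[OF ne]] by (auto simp: vwalk_def)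
    from G.awalk_vwalk_arcs[OF this] have walk: "G.awalk (hd p) ?c (hd p)" using ne by simp
    have verts_c: "pawalk_verts (hd q) (vwalk_arcs q) = q" if "q \<noteq> []" for q :: "'a list"
      using that by (induction q rule: vwalk_arcs.induct) auto
    have "pawalk_verts (hd p) ?c = p @ [hd p]" using verts_c[of "p @ [hd p]"] ne by simp
    then have "distinct (tl (pawalk_verts (hd p) ?c))" using p(1) ne by (cases p) auto
    then have "G.cycle ?c" unfolding G.cycle_def using walk len ne by auto
    then obtain x y where "x \<in> set p" "y \<in> set p" "(x, y) \<in> parcs G" "(x, y) \<notin> set ?c" "(y, x) \<notin> set ?c"
      using G(2) len p(2) set_p unfolding chordal_def by metis
    then show "\<exists>x\<in>set p. \<exists>y\<in>set p. (x, y) \<in> parcs H \<and> (x, y) \<notin> set ?c \<and> (y, x) \<notin> set ?c"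
      using verts_H arcs by auto
  qed
qed

theorem corollary3p4:
  fixes G :: "'a pair_pre_digraph"
  assumes "simple_graph G"
    and "chordal G"
  shows "\<forall>d::nat. odd d \<longrightarrow> kd_perfect 2 d G"
proof (intro allI impI)
  fix d :: nat assume "odd d"
  show "kd_perfect 2 d G"
    unfolding kd_perfect_def
  proof (intro allI impI)
    fix H :: "'a pair_pre_digraph"
    assume H: "induced_subgraph (with_proj H) (with_proj G) \<and> pverts H \<noteq> {}"
    interpret H: pair_sym_digraph H using chordal_relation_induced_subgraph assms H by blast
    interpret C: chordal_relation "parcs H" using chordal_relation_induced_subgraph assms H by blast
    let ?V = "pverts H" and ?P = "(parcs H \<union> Id) ^^ d"
    let ?\<omega> = "kd_clique_number 2 d H" and ?\<chi> = "kd_chromatic 2 d H"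
    let ?size = "\<lambda>S :: 'a set. if finite S then enat (card S) else \<infinity>"
    \<comment> \<open>For \<open>k = 2\<close> the divisor is 1, so the ceiling disappears.\<close>
    have ceil: "ceil_div w (2 - 1) = w" for w by (cases w) (auto simp: ceil_div_def)
    have \<omega>_le: "?\<omega> \<le> enat c" if "f ` ?V \<subseteq> {1..c}"
      "\<forall>i\<in>{1..c}. kd_independent 2 d H {v \<in> ?V. f v = i}" for f and c :: nat
      unfolding kd_clique_number_def
    proof (rule SUP_least)
      fix S assume "S \<in> {S. kd_clique 2 d H S}"
      then have S: "S \<subseteq> ?V" "\<And>u v. \<lbrakk>u \<in> S; v \<in> S; u \<noteq> v\<rbrakk> \<Longrightarrow> (u, v) \<in> ?P"
        by (auto simp: H.kd_clique_2_iff)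
      \<comment> \<open>A colour class contains no two vertices of a clique; injectivity into
        \<open>{1..c}\<close> also rules out infinite cliques.\<close>
      have "inj_on f S"
      proof (rule inj_onI, rule ccontr)
        fix u v assume uv: "u \<in> S" "v \<in> S" "f u = f v" "u \<noteq> v"
        then have "f u \<in> {1..c}" using S(1) that(1) by blast
        then have "kd_independent 2 d H {v \<in> ?V. f v = f u}" using that(2) by blast
        then have "(u, v) \<notin> ?P" using uv S(1) by (simp add: H.kd_independent_2_iff subset_iff)
        then show False using uv S(2) by simp
      qed
      moreover have "f ` S \<subseteq> {1..c}" using S(1) that(1) by auto
      ultimately have "finite S" "card S \<le> card {1..c}"
        using inj_on_finite[of f S "{1..c}"] card_inj_on_le[of f S "{1..c}"] by simp_all
      then show "?size S \<le> enat c" by simp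
    qed
    have "?\<omega> \<le> ?\<chi>"
      unfolding kd_chromatic_def by (rule Inf_greatest) (use \<omega>_le in auto)
    moreover have "?\<chi> \<le> ?\<omega>"
    \<comment> \<open>Only a finite clique number \<open>n\<close> needs work: then every finite
      clique of the power has at most \<open>n\<close> vertices, which is what the colouring with
      \<open>n\<close> colours requires.\<close>
    proof (cases ?\<omega>)
      case (enat n)
      have clique_le: "card S \<le> n"
        if "finite S" "S \<subseteq> ?V" "\<forall>u\<in>S. \<forall>v\<in>S. u \<noteq> v \<longrightarrow> (u, v) \<in> ?P" for S
      proof -
        have "S \<in> {S. kd_clique 2 d H S}" using that by (simp add: H.kd_clique_2_iff)
        then have "?size S \<le> ?\<omega>" unfolding kd_clique_number_def by (rule SUP_upper)
        then show ?thesis using that enat by simp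
      qed
      obtain v where "v \<in> ?V" using H by auto
      \<comment> \<open>The definition of the chromatic number admits only positive numbers of
        colours; a single vertex is a clique.\<close>
      then have "1 \<le> n" using clique_le[of "{v}"] by simp
      have "\<exists>f. f ` ?V \<subseteq> {1..n} \<and>
          (\<forall>u\<in>?V. \<forall>v\<in>?V. u \<noteq> v \<and> (u, v) \<in> ?P \<longrightarrow> f u \<noteq> (f v :: nat))"
        by (rule C.odd_power_colouring[OF \<open>odd d\<close>], rule clique_le)
      then obtain f where f: "f ` ?V \<subseteq> {1..n}"
        "\<forall>u\<in>?V. \<forall>v\<in>?V. u \<noteq> v \<and> (u, v) \<in> ?P \<longrightarrow> f u \<noteq> (f v :: nat)"
        by (elim exE conjE)
      have "kd_independent 2 d H {v \<in> ?V. f v = i}" for i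
        unfolding H.kd_independent_2_iff
      proof (intro conjI ballI impI notI)
        fix u v assume "u \<in> {v \<in> ?V. f v = i}" "v \<in> {v \<in> ?V. f v = i}" "u \<noteq> v" "(u, v) \<in> ?P"
        then show False using f(2)[rule_format, of u v] by simp
      qed simp
      then have "?\<chi> \<le> enat n"
        unfolding kd_chromatic_def by (intro Inf_lower) (use \<open>1 \<le> n\<close> f(1) in blast)
      then show ?thesis using enat by simp
    qed simp
    ultimately show "?\<chi> = ceil_div ?\<omega> (2 - 1)" using ceil by simp
  qed
qed

end
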